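(* Let $A,B\in\mathbb{Q}$ with $AB\neq0$. If $x^4+Ax+B$ has a rational root $r$ and the polynomial $(x^{12}+Ax^3+B)/(x^3-r)$ has a cubic factor in $\mathbb{Q}[x]$, then either $$(A,B)=\bigl(-(r-w)(r^2+w^2),\,-rw(r^2-rw+w^2)\bigr)\quad\text{for some } w\in\mathbb{Q},\ rw(r-w)\neq0,$$ with factorization $$x^{12}+Ax^3+B=(x^3-r)(x^3+w)\bigl(x^6+(r-w)x^3+r^2-rw+w^2\bigr);$$ or, up to scaling, $(A,B)=(128,256)$ or $(A,B)=(-5616,-3888)$, with $$x^{12}+128x^3+256=(x^3+4)(x^3+2x^2+4x+4)(x^6-2x^5+8x^2-16x+16),$$ $$x^{12}-5616x^3-3888=(x^3-18)(x^3+6x+6)(x^6-6x^4+12x^3+36x^2-36x+36).$$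
   Context: Trinomials are considered up to scaling: $x^{12}+Ax^3+B$ and $x^{12}+A\lambda^{9}x^3+B\lambda^{12}$ are identified for $\lambda\in\mathbb{Q}\setminus\{0\}$; "up to scaling $(A,B)=(A_0,B_0)$" means $(A,B)=(A_0\lambda^{9},B_0\lambda^{12})$ for some $\lambda\in\mathbb{Q}\setminus\{0\}$. *)

theory Defs
  imports "HOL-Computational_Algebra.Polynomial"
begin

definition trinomial :: "rat \<Rightarrow> rat \<Rightarrow> rat poly" where
  "trinomial A B = monom 1 12 + monom A 3 + [:B:]"

text \<open>
  Replacing \<open>x\<close> by \<open>x / l\<close> in \<open>trinomial A B\<close> and clearing denominators multiplies
  \<open>A\<close> by \<open>l ^ 9\<close> and \<open>B\<close> by \<open>l ^ 12\<close>.
\<close>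

definition eq_up_to_scaling :: "rat \<times> rat \<Rightarrow> rat \<times> rat \<Rightarrow> bool" where
  "eq_up_to_scaling p q \<longleftrightarrow>
     (\<exists>l. l \<noteq> 0 \<and> p = (fst q * l ^ 9, snd q * l ^ 12))"

text \<open>
  A factor is just a divisor of degree three; it need not be irreducible.
\<close>

definition has_cubic_factor :: "rat poly \<Rightarrow> bool" where
  "has_cubic_factor p \<longleftrightarrow> (\<exists>g. degree g = 3 \<and> g dvd p)"

end

theory Submission
  imports Defs "HOL-Number_Theory.Cong" "HOL-Computational_Algebra.Nth_Powers"
    "HOL-Computational_Algebra.Polynomial_Factorial" "HOL-Computational_Algebra.Field_as_Ring"
begin

text \<open>
  With \<open>s = r\<^sup>3 + A\<close>, the quotient of the trinomial by \<open>x\<^sup>3 - r\<close> is \<open>h(x\<^sup>3)\<close> for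
  \<open>h(y) = y\<^sup>3 + r y\<^sup>2 + r\<^sup>2 y + s\<close>. A rational root \<open>-w\<close> of \<open>h\<close> gives the family. Otherwise \<open>h\<close> is
  irreducible, so a factor \<open>g = x\<^sup>3 + a x\<^sup>2 + b x + c\<close> of \<open>h(x\<^sup>3)\<close> forces \<open>h(x\<^sup>3)\<close> to be the product of
  \<open>g(\<zeta>x)\<close> over the cube roots of unity \<open>\<zeta>\<close>. Comparing coefficients and eliminating \<open>r\<close> leaves
  \<open>3 u v = t\<^sup>3\<close> with \<open>u = c + a\<^sup>3 - 2ab\<close>, \<open>v = 2c - ab\<close>, \<open>t = b - a\<^sup>2\<close>. Then \<open>2u\<close>, \<open>-v\<close>, \<open>a\<^sup>3\<close> are three
  numbers with sum \<open>9n\<close> and product \<open>18n\<^sup>3\<close>, where \<open>n = -at/3\<close>. This is an elliptic curve with a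
  rational 3-isogeny. A descent through the isogeny and its dual shows that \<open>n = 0\<close>: the three
  numbers, once coprime, are \<open>18\<close> times a cube and two cubes; this yields a solution of
  \<open>V\<^sup>2 + 3N\<^sup>2(N\<^sup>2 - 3M)\<^sup>2 = 4M\<^sup>3\<close> with \<open>\<bar>N\<bar> \<le> \<bar>n\<bar>\<close>; and writing the left side as the norm of a cube in
  \<open>\<int>[\<surd>-3]\<close> gives a new triple with \<open>n\<close> replaced by \<open>N/3\<close>.
\<close>

subsection \<open>Cubes represented by the form \<open>x\<^sup>2 + 3y\<^sup>2\<close>\<close>

lemma int_cube_inject: "(a::int) ^ 3 = b ^ 3 \<longleftrightarrow> a = b"
proof
  assume eq: "a ^ 3 = b ^ 3"
  have "(a - b) * ((2 * a + b) ^ 2 + 3 * b ^ 2) = 4 * (a ^ 3 - b ^ 3)"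
    by (simp add: power2_eq_square power3_eq_cube algebra_simps)
  then consider "a = b" | "(2 * a + b) ^ 2 + 3 * b ^ 2 = 0"
    using eq by auto
  then show "a = b"
    by cases (auto simp: add_nonneg_eq_0_iff)
qed simp

lemma int_coprimeI_prime:
  assumes "\<And>l. prime l \<Longrightarrow> l dvd a \<Longrightarrow> l dvd b \<Longrightarrow> False"
  shows "coprime (a::int) b"
proof (rule ccontr)
  assume "\<not> coprime a b"
  then have "\<not> is_unit (gcd a b)"
    by (simp only: is_unit_gcd_iff coprime_iff_gcd_eq_1) simp
  then have "gcd a b = 0 \<or> (\<exists>l. prime l \<and> l dvd gcd a b)"
    using prime_divisor_exists by blast
  moreover have "prime (2::int)"
    by simp
  ultimately show False
    using assms by (metis dvd_0_right gcd_eq_0_iff gcd_greatest_iff)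
qed

text \<open>Absolute values reduce this to the natural numbers; the sign is harmless because -1 is a
  cube.\<close>

lemma coprime_mult_eq_cube_int:
  fixes a b c :: int
  assumes "coprime a b" "a * b = c ^ 3"
  shows "\<exists>k. a = k ^ 3"
proof -
  have "nat \<bar>a\<bar> * nat \<bar>b\<bar> = nat \<bar>c\<bar> ^ 3"
    by (metis assms(2) abs_mult abs_ge_zero nat_mult_distrib nat_power_eq power_abs)
  moreover have "coprime (nat \<bar>a\<bar>) (nat \<bar>b\<bar>)"
    using assms(1) by (simp add: coprime_int_iff)
  ultimately obtain k where "nat \<bar>a\<bar> = k ^ 3"
    using is_nth_power_mult_coprime_nat_iff[of "nat \<bar>a\<bar>" "nat \<bar>b\<bar>" 3]
    by (auto simp: is_nth_power_def)
  then have "\<bar>a\<bar> = (int k) ^ 3"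
    by (metis abs_ge_zero int_nat_eq of_nat_power)
  then have "a = (int k) ^ 3 \<or> a = (- int k) ^ 3"
    by auto
  then show ?thesis
    by blast
qed

lemma coprime_mult_mult_eq_cube_int:
  fixes a b c d :: int
  assumes "coprime a b" "coprime a c" "coprime b c" "a * b * c = d ^ 3"
  shows "\<exists>x y z. a = x ^ 3 \<and> b = y ^ 3 \<and> c = z ^ 3 \<and> x * y * z = d"
proof -
  have "coprime a (b * c)" "coprime b (a * c)" "coprime c (a * b)"
    using assms(1-3) by (simp_all add: coprime_commute)
  then obtain x y z where "a = x ^ 3" "b = y ^ 3" "c = z ^ 3"
    using coprime_mult_eq_cube_int[of a "b * c" d] coprime_mult_eq_cube_int[of b "a * c" d]
      coprime_mult_eq_cube_int[of c "a * b" d] assms(4) by (auto simp: mult_ac)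
  then show ?thesis
    using assms(4) by (metis int_cube_inject power_mult_distrib)
qed

lemma ex_floor_sqrt:
  fixes m :: int
  assumes "m \<ge> 0"
  shows "\<exists>k::nat. int k ^ 2 \<le> m \<and> m < (int k + 1) ^ 2"
proof -
  define k where "k = (LEAST k::nat. m < (int k + 1) ^ 2)"
  have "m < (int (nat m) + 1) ^ 2"
    using assms by (simp add: power2_eq_square algebra_simps) (smt (verit) mult_nonneg_nonneg)
  then have "m < (int k + 1) ^ 2"
    unfolding k_def by (rule LeastI)
  moreover have "int k ^ 2 \<le> m"
  proof (cases k)
    case (Suc j)
    then have "\<not> m < (int j + 1) ^ 2"
      unfolding k_def by (metis lessI not_less_Least)
    then show ?thesis
      using Suc by (simp add: add.commute)
  qed (use assms in simp)
  ultimately show ?thesis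
    by blast
qed

text \<open>Thue's pigeonhole argument. The two side lengths of the box are chosen so that the case of
  a square modulus needs no separate treatment.\<close>

lemma thue_small_solution:
  fixes t m :: int
  assumes "m > 0"
  shows "\<exists>p q. (p, q) \<noteq> (0, 0) \<and> m dvd p - t * q \<and> p ^ 2 \<le> m \<and> q ^ 2 < m"
proof -
  obtain k where k: "int k ^ 2 \<le> m" "m < (int k + 1) ^ 2"
    using ex_floor_sqrt[of m] assms by auto
  \<comment> \<open>Starting from \<open>m - 1\<close> makes \<open>q ^ 2 < m\<close> strict, which
    later keeps \<open>p ^ 2 + 3 * q ^ 2\<close> below \<open>4 * m\<close>; the box still has more
    than \<open>m\<close> points.\<close>
  obtain l where l: "int l ^ 2 < m" "m \<le> (int l + 1) ^ 2"
    using ex_floor_sqrt[of "m - 1"] assms by force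
  define f where "f = (\<lambda>(x::nat, y::nat). (int x - t * int y) mod m)"
  have "m * m < (int k + 1) ^ 2 * (int l + 1) ^ 2"
    using k(2) l(2) assms by (intro mult_less_le_imp_less) auto
  then have "m ^ 2 < ((int k + 1) * (int l + 1)) ^ 2"
    by (simp only: power_mult_distrib) (simp add: power2_eq_square)
  then have "m < (int k + 1) * (int l + 1)"
    by (rule power_less_imp_less_base) simp
  then have "card {0..<m} < card ({..k} \<times> {..l})"
    using assms by (simp add: card_cartesian_product nat_less_iff algebra_simps)
  moreover have "f ` ({..k} \<times> {..l}) \<subseteq> {0..<m}"
    using assms by (auto simp: f_def)
  ultimately have "\<not> inj_on f ({..k} \<times> {..l})"
    by (meson card_inj_on_le finite_atLeastLessThan_int leD)
  then obtain x y x' y' where xy: "x \<le> k" "x' \<le> k" "y \<le> l" "y' \<le> l"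
      "(x, y) \<noteq> (x', y')" "f (x, y) = f (x', y')"
    unfolding inj_on_def by fastforce
  have bound: "(int u - int v) ^ 2 \<le> int n ^ 2" if "u \<le> n" "v \<le> n" for u v n
    using that by (intro abs_le_square_iff[THEN iffD1]) auto
  have "m dvd (int x - int x') - t * (int y - int y')"
    using xy(6) by (simp add: f_def mod_eq_dvd_iff algebra_simps)
  then show ?thesis
    using xy(5) bound[OF xy(1,2)] bound[OF xy(3,4)] k(1) l(1)
    by (intro exI[of _ "int x - int x'"] exI[of _ "int y - int y'"]) auto
qed


text \<open>The pairs \<open>(p, q)\<close> with \<open>m dvd p - t * q\<close> form an ideal of \<open>\<int>[\<surd>-3]\<close>, which contains
  an element of norm \<open>k * m\<close> with \<open>0 < k < 4\<close>. The case \<open>k = 2\<close> is impossible modulo 4, and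
  for \<open>k = 3\<close> one divides by \<open>\<surd>-3\<close>.\<close>

lemma norm_form_represents:
  fixes t m :: int
  assumes "m > 0" "odd m" "\<not> 3 dvd m" "m dvd t ^ 2 + 3"
  shows "\<exists>p q. p ^ 2 + 3 * q ^ 2 = m \<and> m dvd p - t * q"
proof -
  obtain p q where pq: "(p, q) \<noteq> (0, 0)" "m dvd p - t * q" "p ^ 2 \<le> m" "q ^ 2 < m"
    using thue_small_solution[OF assms(1), of t] by blast
  have "p ^ 2 + 3 * q ^ 2 = (p - t * q) * (p + t * q) + (t ^ 2 + 3) * q ^ 2"
    by (simp add: power2_eq_square algebra_simps)
  then have "m dvd p ^ 2 + 3 * q ^ 2"
    using pq(2) assms(4) by simp
  then obtain k where k: "p ^ 2 + 3 * q ^ 2 = m * k" ..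
  have "0 < p ^ 2 + 3 * q ^ 2"
    using pq(1) by (metis add_cancel_right_left add_nonneg_pos add_pos_nonneg mult_eq_0_iff mult_pos_pos
        prod.inject zero_le_power2 zero_less_numeral zero_less_power2 mult_nonneg_nonneg zero_le_numeral)
  then have "0 < k"
    using k assms(1) by (simp add: zero_less_mult_iff)
  moreover have "m * k < m * 4"
    using k pq(3,4) by linarith
  then have "k < 4"
    using assms(1) by simp
  ultimately consider "k = 1" | "k = 2" | "k = 3"
    by linarith
  then show ?thesis
  proof cases
    case 1
    then show ?thesis
      using k pq(2) by auto
  next
    case 2
    have "even p \<longleftrightarrow> even q"
      using k 2 by (metis even_add even_mult_iff even_numeral odd_numeral even_power zero_less_numeral)
    then have "4 dvd p ^ 2 + 3 * q ^ 2"
    proof (cases "even p")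
      case True
      then show ?thesis
        using \<open>even p \<longleftrightarrow> even q\<close> by (auto elim!: evenE simp: power2_eq_square)
    next
      case False
      then show ?thesis
        using \<open>even p \<longleftrightarrow> even q\<close> by (auto elim!: oddE simp: power2_eq_square algebra_simps)
    qed
    then have "4 dvd m * 2"
      using k 2 by simp
    then show ?thesis
      using assms(2) by presburger
  next
    case 3
    then have "3 dvd p ^ 2"
      using k by presburger
    then have "3 dvd p"
      using prime_dvd_power[of "3::int" p 2] by simp
    then obtain s where s: "p = 3 * s" ..
    \<comment> \<open>Since p + q\<surd>-3 = \<surd>-3 (q - s\<surd>-3), the pair
      \<open>(q, - s)\<close> takes the place of \<open>(p, q)\<close>.\<close>
    have "3 * (q - t * (- s)) = t * (p - t * q) + (t ^ 2 + 3) * q"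
      by (simp add: s power2_eq_square algebra_simps)
    then have "m dvd 3 * (q - t * (- s))"
      using pq(2) assms(4) by simp
    moreover have "coprime m 3"
      using assms(3) prime_imp_coprime[of "3::int" m] by (simp add: coprime_commute)
    ultimately have "m dvd q - t * (- s)"
      by (simp only: coprime_dvd_mult_right_iff)
    moreover have "q ^ 2 + 3 * (- s) ^ 2 = m"
      using k 3 s by (simp add: power2_eq_square)
    ultimately show ?thesis
      by blast
  qed
qed

text \<open>Writing \<open>\<alpha> = a + b\<surd>-3\<close> and choosing \<open>\<gamma> = p + q\<surd>-3\<close> of norm \<open>m\<close> with \<open>p \<equiv> t q\<close> modulo \<open>m\<close>,
  where \<open>a \<equiv> t b\<close> modulo \<open>m\<^sup>3\<close>, the product of \<open>\<alpha>\<close> and the conjugate of \<open>\<gamma>\<^sup>3\<close> is divisible by \<open>m\<^sup>3\<close>;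
  the quotient has norm 1, so that \<open>\<alpha> = \<gamma>\<^sup>3\<close> or \<open>\<alpha> = - \<gamma>\<^sup>3\<close>. No unique factorization is needed.\<close>

lemma norm_form_eq_cube:
  fixes a b m :: int
  assumes "m > 0" "odd m" "\<not> 3 dvd m" "coprime b m" "a ^ 2 + 3 * b ^ 2 = m ^ 3"
  shows "\<exists>p q. p ^ 2 + 3 * q ^ 2 = m \<and> a = p ^ 3 - 9 * p * q ^ 2 \<and> b = 3 * p ^ 2 * q - 3 * q ^ 3"
proof -
  have "coprime b (m ^ 3)"
    using assms(4) by simp
  then obtain b' where "[b * b' = 1] (mod m ^ 3)"
    using cong_solve_coprime_int by blast
  then have b': "m ^ 3 dvd b * b' - 1"
    by (simp add: cong_iff_dvd_diff)
  define t where "t = a * b'"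
  have "a - t * b = - a * (b * b' - 1)"
    by (simp add: t_def algebra_simps)
  then have at: "m ^ 3 dvd a - t * b"
    using b' by simp
  have "b ^ 2 * (t ^ 2 + 3) = m ^ 3 - (a - t * b) * (a + t * b)"
    unfolding assms(5)[symmetric] by (simp add: power2_eq_square algebra_simps)
  then have "m ^ 3 dvd b ^ 2 * (t ^ 2 + 3)"
    using at by simp
  then have t: "m ^ 3 dvd t ^ 2 + 3"
    using \<open>coprime b (m ^ 3)\<close> by (simp add: coprime_dvd_mult_right_iff coprime_commute)
  then have "m dvd t ^ 2 + 3"
    by (meson dvd_power dvd_trans zero_less_numeral)
  then obtain p q where pq: "p ^ 2 + 3 * q ^ 2 = m" "m dvd p - t * q"
    using norm_form_represents[OF assms(1-3)] by blast
  define c where "c = p ^ 3 - 9 * p * q ^ 2"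
  define d where "d = 3 * p ^ 2 * q - 3 * q ^ 3"
  have cd: "c ^ 2 + 3 * d ^ 2 = m ^ 3"
    unfolding pq(1)[symmetric] c_def d_def by (simp add: power2_eq_square power3_eq_cube algebra_simps)
  have "c - t * d = (p - t * q) ^ 3 + (t ^ 2 + 3) * (q ^ 3 * t - 3 * p * q ^ 2)"
    by (simp add: c_def d_def power2_eq_square power3_eq_cube algebra_simps)
  moreover have "m ^ 3 dvd (p - t * q) ^ 3"
    using pq(2) by (rule dvd_power_same)
  ultimately have ct: "m ^ 3 dvd c - t * d"
    using t by simp
  have "a * c + 3 * b * d = (a - t * b) * c + t * b * (c - t * d) + (t ^ 2 + 3) * (b * d)"
    by (simp add: power2_eq_square algebra_simps)
  then have "m ^ 3 dvd a * c + 3 * b * d"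
    using at ct t by simp
  then obtain x where x: "a * c + 3 * b * d = m ^ 3 * x" ..
  have "b * c - a * d = b * (c - t * d) - (a - t * b) * d"
    by (simp add: algebra_simps)
  then have "m ^ 3 dvd b * c - a * d"
    using at ct by simp
  then obtain y where y: "b * c - a * d = m ^ 3 * y" ..
  have "(m ^ 3) ^ 2 * (x ^ 2 + 3 * y ^ 2) = (a * c + 3 * b * d) ^ 2 + 3 * (b * c - a * d) ^ 2"
    unfolding x y by (simp add: power_mult_distrib algebra_simps)
  also have "\<dots> = (a ^ 2 + 3 * b ^ 2) * (c ^ 2 + 3 * d ^ 2)"
    by (simp add: power2_eq_square algebra_simps)
  also have "\<dots> = (m ^ 3) ^ 2"
    using assms(5) cd by (simp add: power2_eq_square)
  finally have xy: "x ^ 2 + 3 * y ^ 2 = 1"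
    using assms(1) by simp
  have "y = 0"
  proof (rule ccontr)
    assume "y \<noteq> 0"
    then have "y ^ 2 > 0"
      by simp
    then show False
      using xy zero_le_power2[of x] by linarith
  qed
  then have "x ^ 2 = 1"
    using xy by simp
  then have "x = 1 \<or> x = - 1"
    by (simp add: power2_eq_1_iff)
  moreover have "m ^ 3 * a = (a * c + 3 * b * d) * c - 3 * (b * c - a * d) * d"
    unfolding cd[symmetric] by (simp add: power2_eq_square algebra_simps)
  then have "m ^ 3 * a = m ^ 3 * (x * c)"
    using x y \<open>y = 0\<close> by simp
  then have "a = x * c"
    using assms(1) by simp
  moreover have "m ^ 3 * b = (a * c + 3 * b * d) * d + (b * c - a * d) * c"
    unfolding cd[symmetric] by (simp add: power2_eq_square algebra_simps)
  then have "m ^ 3 * b = m ^ 3 * (x * d)"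
    using x y \<open>y = 0\<close> by simp
  then have "b = x * d"
    using assms(1) by simp
  ultimately consider "a = c" "b = d" | "a = - c" "b = - d"
    by auto
  then show ?thesis
  proof cases
    case 1
    then show ?thesis
      using pq(1) c_def d_def by blast
  next
    case 2
    then show ?thesis
      using pq(1) by (intro exI[of _ "- p"] exI[of _ "- q"]) (simp add: c_def d_def)
  qed
qed

subsection \<open>The 3-isogeny descent\<close>

lemma three_dvd_cube_minus_self:
  fixes x :: int
  shows "3 dvd x ^ 3 - x"
proof -
  have "x ^ 3 - x = (x - 1) * x * (x + 1)"
    by (simp add: power3_eq_cube algebra_simps)
  moreover have "3 dvd (x - 1) \<or> 3 dvd x \<or> 3 dvd (x + 1)"
    by presburger
  ultimately show ?thesis
    by auto
qed

text \<open>Put \<open>W = N(N\<^sup>2 - 3M)\<close>. The class of \<open>(V + W\<surd>-3) / 2\<close> modulo cubes is a cube root of unity. It is 1 when \<open>W\<close> is even,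
  and a primitive one when \<open>W\<close> is odd, which is excluded modulo 9.\<close>

lemma descent_dual:
  fixes M N V :: int
  assumes "V ^ 2 + 3 * (N * (N ^ 2 - 3 * M)) ^ 2 = 4 * M ^ 3" "coprime M N"
  shows "\<exists>p q. N ^ 3 - 3 * N * (p ^ 2 + 3 * q ^ 2) = 6 * q * (p ^ 2 - q ^ 2)"
proof -
  define W where "W = N * (N ^ 2 - 3 * M)"
  have eq: "V ^ 2 + 3 * W ^ 2 = 4 * M ^ 3"
    using assms(1) by (simp add: W_def)
  have WN: "W = N ^ 3 - 3 * N * M"
    by (simp add: W_def power2_eq_square power3_eq_cube algebra_simps)
  have coW: "coprime W M"
  proof (rule int_coprimeI_prime)
    fix l :: int assume l: "prime l" "l dvd W" "l dvd M"
    have "N ^ 3 = W + 3 * N * M"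
      by (simp add: WN)
    then have "l dvd N ^ 3"
      using l by simp
    then have "l dvd N"
      using l(1) prime_dvd_power by blast
    then show False
      using l assms(2) by (metis coprime_common_divisor not_prime_unit)
  qed
  have "M \<noteq> 0"
  proof
    assume "M = 0"
    then have "W = 0"
      using eq by (simp add: add_nonneg_eq_0_iff)
    then show False
      using \<open>M = 0\<close> coW by simp
  qed
  moreover have "0 \<le> M ^ 3"
    using eq zero_le_power2[of V] zero_le_power2[of W] by linarith
  ultimately have "M > 0"
    by (simp add: zero_le_power_eq)
  have "\<not> 3 dvd M"
  proof
    assume "3 dvd M"
    then obtain k where k: "M = 3 * k" ..
    have "V ^ 2 = 3 * (36 * k ^ 3 - W ^ 2)"
      using eq by (simp add: k power_mult_distrib)
    then have "3 dvd V"
      using prime_dvd_power[of "3::int" V 2] by simp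
    then obtain v where "V = 3 * v" ..
    then have "W ^ 2 = 3 * (12 * k ^ 3 - v ^ 2)"
      using eq by (simp add: k power_mult_distrib)
    then have "3 dvd W"
      using prime_dvd_power[of "3::int" W 2] by simp
    then show False
      using \<open>3 dvd M\<close> coW coprime_common_divisor[of W M 3] by simp
  qed
  have "even V \<longleftrightarrow> even W"
    using eq by (metis even_add even_mult_iff even_numeral odd_numeral even_power zero_less_numeral)
  have "odd M"
  proof
    assume "even M"
    then have "odd W"
      using coW by (metis coprime_common_divisor odd_one)
    then obtain v w where vw: "V = 2 * v + 1" "W = 2 * w + 1"
      using \<open>even V \<longleftrightarrow> even W\<close> by (metis oddE)
    obtain k where "M = 2 * k"
      using \<open>even M\<close> by blast
    \<comment> \<open>For odd \<open>V\<close> and \<open>W\<close> the left side is 4 modulo 8,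
      whereas \<open>4 * M ^ 3\<close> is divisible by 32.\<close>
    then have "4 * (v * (v + 1)) + 12 * (w * (w + 1)) + 4 = 32 * k ^ 3"
      using eq vw by (simp add: power2_eq_square power_mult_distrib algebra_simps)
    moreover obtain x y where "v * (v + 1) = 2 * x" "w * (w + 1) = 2 * y"
      by (metis dvdE even_mult_iff even_plus_one_iff)
    ultimately have "8 * x + 24 * y + 4 = 32 * k ^ 3"
      by simp
    then show False
      by presburger
  qed
  show ?thesis
  proof (cases "even W")
    case True
    then obtain v w where vw: "V = 2 * v" "W = 2 * w"
      using \<open>even V \<longleftrightarrow> even W\<close> by blast
    then have "v ^ 2 + 3 * w ^ 2 = M ^ 3"
      using eq by (simp add: power_mult_distrib)
    moreover have "coprime w M"
      using coW vw by simp
    ultimately obtain p q where pq: "p ^ 2 + 3 * q ^ 2 = M" "w = 3 * p ^ 2 * q - 3 * q ^ 3"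
      using norm_form_eq_cube[OF \<open>M > 0\<close> \<open>odd M\<close> \<open>\<not> 3 dvd M\<close>] by blast
    have "N ^ 3 - 3 * N * M = 6 * q * (p ^ 2 - q ^ 2)"
      using WN vw pq(2) by (simp add: power2_eq_square power3_eq_cube algebra_simps)
    then show ?thesis
      using pq(1) by blast
  next
    case False
    \<comment> \<open>A suitable sign of \<open>V\<close> gives \<open>v = W + 4 * s\<close>. Then
      (v + W\<surd>-3)/2 times the unit (1 - \<surd>-3)/2 equals (W + s) - s\<surd>-3, whose
      coefficients are integers.\<close>
    then have "4 dvd V - W \<or> 4 dvd - V - W"
      using \<open>even V \<longleftrightarrow> even W\<close> by presburger
    then obtain v where v: "v ^ 2 = V ^ 2" "4 dvd v - W"
      by (metis power2_minus)
    then obtain s where s: "v = W + 4 * s"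
      by (metis add.commute diff_add_cancel dvdE)
    have "4 * ((W + s) ^ 2 + 3 * s ^ 2) = v ^ 2 + 3 * W ^ 2"
      by (simp add: s power2_eq_square algebra_simps)
    then have ws: "(W + s) ^ 2 + 3 * s ^ 2 = M ^ 3"
      using eq v(1) by simp
    have "coprime s M"
    proof (rule int_coprimeI_prime)
      fix l :: int assume l: "prime l" "l dvd s" "l dvd M"
      have "(W + s) ^ 2 = M ^ 3 - 3 * s ^ 2"
        using ws by simp
      then have "l dvd (W + s) ^ 2"
        using l by (simp add: power2_eq_square power3_eq_cube)
      then have "l dvd W + s"
        using l(1) prime_dvd_power by blast
      then have "l dvd W"
        using l(2) by (simp add: dvd_add_left_iff)
      then show False
        using l coW by (metis coprime_common_divisor not_prime_unit)
    qed
    then obtain p q where pq: "p ^ 2 + 3 * q ^ 2 = M" "W + s = p ^ 3 - 9 * p * q ^ 2"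
        "s = 3 * p ^ 2 * q - 3 * q ^ 3"
      using norm_form_eq_cube[OF \<open>M > 0\<close> \<open>odd M\<close> \<open>\<not> 3 dvd M\<close> _ ws] by blast
    have W: "N ^ 3 - 3 * N * M = p ^ 3 - 9 * p * q ^ 2 - 3 * p ^ 2 * q + 3 * q ^ 3"
      using WN pq(2,3) by simp
    \<comment> \<open>Modulo 3 the equation gives \<open>N\<close> congruent to \<open>p\<close>.
      With \<open>N = p + 3 * k\<close> it then shows, modulo 9, that 3 divides
      \<open>p ^ 3 - p ^ 2 * q + q ^ 3\<close>. Modulo 3 this is p - q + q = p, but 3 does not
      divide \<open>p\<close>.\<close>
    have "N ^ 3 - p ^ 3 = 3 * (N * M - 3 * p * q ^ 2 - p ^ 2 * q + q ^ 3)"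
      using W by simp
    then have "3 dvd N ^ 3 - p ^ 3"
      by simp
    then have "3 dvd N - p"
      using three_dvd_cube_minus_self[of N] three_dvd_cube_minus_self[of p] by presburger
    then obtain k where k: "N = p + 3 * k"
      by (metis add.commute diff_add_cancel dvdE)
    have "3 * (p ^ 3 - p ^ 2 * q + q ^ 3) = 9 * (p ^ 2 * k + 3 * p * k ^ 2 + 3 * k ^ 3 - k * M)"
      using W unfolding pq(1)[symmetric] k by (simp add: power2_eq_square power3_eq_cube algebra_simps)
    then have "3 dvd p ^ 3 - p ^ 2 * q + q ^ 3"
      by presburger
    moreover have "\<not> 3 dvd p"
      using \<open>\<not> 3 dvd M\<close> by (auto simp: pq(1)[symmetric] power2_eq_square)
    then have "3 dvd p ^ 2 - 1"
    proof -
      have "3 dvd p - 1 \<or> 3 dvd p + 1"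
        using \<open>\<not> 3 dvd p\<close> by presburger
      then have "3 dvd (p - 1) * (p + 1)"
        by auto
      then show ?thesis
        by (simp add: power2_eq_square algebra_simps)
    qed
    then have "3 dvd (p ^ 2 - 1) * q"
      by simp
    moreover have "p = (p ^ 3 - p ^ 2 * q + q ^ 3) - (p ^ 3 - p) - (q ^ 3 - q) + (p ^ 2 - 1) * q"
      by (simp add: algebra_simps)
    ultimately have "3 dvd p"
      using three_dvd_cube_minus_self[of p] three_dvd_cube_minus_self[of q] by (metis dvd_add dvd_diff)
    then have False
      using \<open>\<not> 3 dvd p\<close> by simp
    then show ?thesis ..
  qed
qed

section \<open>Coprime triples with sum 9n and product 18n^3\<close>

lemma three_dvd_coprime_cofactor:
  fixes u v w n :: int
  assumes "coprime u v" "coprime u w" "u * v * w = 18 * n ^ 3" "3 dvd u"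
  shows "9 dvd u"
proof -
  have "coprime 3 v" "coprime 3 w"
    using coprime_divisors[OF assms(4) dvd_refl[of v]] coprime_divisors[OF assms(4) dvd_refl[of w]] assms(1,2)
    by blast+
  then have "coprime (3 ^ 2) (v * w)"
    by (simp only: coprime_power_left_iff coprime_mult_right_iff) simp
  moreover have "3 ^ 2 * (2 * n ^ 3) = u * (v * w)"
    using assms(3) by (simp add: mult.assoc)
  then have "3 ^ 2 dvd u * (v * w)"
    by (metis dvd_triv_left)
  ultimately have "3 ^ 2 dvd u"
    using coprime_dvd_mult_left_iff by blast
  then show ?thesis
    by simp
qed

text \<open>If 2 and 9 fell on different members, the triple would be 2a^3, 9z, c^3, so 2a^3 + c^3
  would vanish modulo 9. This forces c = a modulo 3, then 3 divides \<open>a\<close>, and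
  \<open>u\<close> and \<open>v\<close> share the factor 3.\<close>

lemma coprime_factors_2_9_1:
  fixes u v w n :: int
  assumes co: "coprime u v" "coprime u w" "coprime v w"
    and "u + v + w = 9 * n" "u * v * w = 18 * n ^ 3" "2 dvd u" "3 dvd v"
  shows False
proof -
  obtain y where y: "u = 2 * y"
    using assms(6) by blast
  have "9 dvd v"
    using three_dvd_coprime_cofactor[of v u w n] assms by (simp add: coprime_commute mult_ac)
  then obtain z where z: "v = 9 * z" ..
  have "y * z * w = n ^ 3"
    using assms(5) y z by simp
  moreover have "coprime y z" "coprime y w" "coprime z w"
    using co by (simp_all add: y z)
  ultimately obtain a b c where abc: "y = a ^ 3" "w = c ^ 3"
    using coprime_mult_mult_eq_cube_int by blast
  have "2 * a ^ 3 + c ^ 3 = 9 * (n - z)"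
    using assms(4) y z abc by simp
  then have "3 dvd c - a"
    using three_dvd_cube_minus_self[of a] three_dvd_cube_minus_self[of c] by presburger
  then obtain k where k: "c = a + 3 * k"
    by (metis add.commute diff_add_cancel dvdE)
  have "3 * a ^ 3 = 9 * (n - z - a ^ 2 * k - 3 * a * k ^ 2 - 3 * k ^ 3)"
    using \<open>2 * a ^ 3 + c ^ 3 = 9 * (n - z)\<close>
    by (simp add: k power2_eq_square power3_eq_cube algebra_simps)
  then have "3 dvd a ^ 3"
    by presburger
  then have "3 dvd u"
    by (simp add: y abc)
  then show False
    using assms(7) co(1) coprime_common_divisor[of u v 3] by simp
qed

lemma coprime_factors_18_1_1:
  fixes u v w n :: int
  assumes co: "coprime u v" "coprime u w" "coprime v w"
    and "u + v + w = 9 * n" "u * v * w = 18 * n ^ 3" "2 dvd u"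
  shows "\<exists>a b c. 18 * a ^ 3 + b ^ 3 + c ^ 3 = 9 * a * b * c \<and> a * b * c = n \<and> coprime b c"
proof -
  have "3 dvd u * v * w"
    using assms(5) by simp
  moreover have "\<not> 3 dvd v"
    using coprime_factors_2_9_1[OF assms] by blast
  moreover have "\<not> 3 dvd w"
    using coprime_factors_2_9_1[of u w v n] assms by (auto simp: coprime_commute mult_ac add_ac)
  ultimately have "3 dvd u"
    by (simp add: prime_dvd_mult_iff)
  then have "9 dvd u"
    using three_dvd_coprime_cofactor assms by blast
  then have "18 dvd u"
    using assms(6) by presburger
  then obtain y where y: "u = 18 * y" ..
  have "y * v * w = n ^ 3"
    using assms(5) y by simp
  moreover have "coprime y v" "coprime y w"
    using co by (simp_all add: y)
  ultimately obtain a b c where abc: "y = a ^ 3" "v = b ^ 3" "w = c ^ 3" "a * b * c = n"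
    using coprime_mult_mult_eq_cube_int[of y v w n] co(3) by blast
  moreover have "coprime b c"
    using co(3) by (simp add: abc)
  ultimately show ?thesis
    using assms(4) y by (intro exI[of _ a] exI[of _ b] exI[of _ c]) (simp add: mult.assoc)
qed

text \<open>A prime dividing exactly two members cannot divide 9n, because of the sum. Its square
  divides 18n^3, hence divides 2, which is absurd. So the members are pairwise coprime, and the even
  one carries the whole factor 18.\<close>

lemma descent_primal:
  fixes u v w n :: int
  assumes "u + v + w = 9 * n" "u * v * w = 18 * n ^ 3"
    and prim: "\<And>l. prime l \<Longrightarrow> l dvd u \<Longrightarrow> l dvd v \<Longrightarrow> l dvd w \<Longrightarrow> False"
  shows "\<exists>a b c. 18 * a ^ 3 + b ^ 3 + c ^ 3 = 9 * a * b * c \<and> a * b * c = n \<and> coprime b c"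
proof -
  have co: "coprime x y" if x: "x + y + z = 9 * n" "x * y * z = 18 * n ^ 3"
    "\<And>l. prime l \<Longrightarrow> l dvd x \<Longrightarrow> l dvd y \<Longrightarrow> l dvd z \<Longrightarrow> False" for x y z
  proof (rule int_coprimeI_prime)
    fix l :: int assume l: "prime l" "l dvd x" "l dvd y"
    have z: "z = 9 * n - x - y"
      using x(1) by simp
    have "\<not> l dvd n" "\<not> l dvd 9"
      using x(3)[of l] l by (auto simp: z)
    have "l ^ 2 dvd 18 * n ^ 3"
      using l(2,3) by (metis x(2) dvd_mult2 mult_dvd_mono power2_eq_square)
    moreover have "coprime l n"
      using l(1) \<open>\<not> l dvd n\<close> by (rule prime_imp_coprime)
    ultimately have "l ^ 2 dvd 2 * 3 ^ 2"
      by (simp add: coprime_dvd_mult_left_iff)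
    moreover have "coprime l (3 ^ 2)"
      using prime_imp_coprime[OF l(1) \<open>\<not> l dvd 9\<close>] by simp
    then have "coprime (l ^ 2) (3 ^ 2)"
      by simp
    ultimately have "l ^ 2 dvd 2"
      by (simp only: coprime_dvd_mult_left_iff)
    then have "l ^ 2 \<le> 2"
      by (rule zdvd_imp_le) simp
    moreover have "2 * 2 \<le> l * l"
      using prime_ge_2_int[OF l(1)] by (intro mult_mono) auto
    ultimately show False
      by (simp add: power2_eq_square)
  qed
  have "coprime u v"
    by (rule co[of u v w]) (use assms in \<open>auto simp: mult_ac add_ac\<close>)
  moreover have "coprime u w"
    by (rule co[of u w v]) (use assms in \<open>auto simp: mult_ac add_ac\<close>)
  moreover have "coprime v w"
    by (rule co[of v w u]) (use assms in \<open>auto simp: mult_ac add_ac\<close>)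
  moreover have "2 dvd u * v * w"
    using assms(2) by simp
  then have "2 dvd u \<or> 2 dvd v \<or> 2 dvd w"
    by simp
  moreover have "v + u + w = 9 * n" "w + u + v = 9 * n" "v * u * w = 18 * n ^ 3" "w * u * v = 18 * n ^ 3"
    using assms(1,2) by (simp_all add: mult_ac add_ac)
  ultimately show ?thesis
    using coprime_factors_18_1_1[of u v w n] coprime_factors_18_1_1[of v u w n]
      coprime_factors_18_1_1[of w u v n] assms(1,2) coprime_commute by blast
qed

section \<open>Back to the norm equation, and the infinite descent\<close>

text \<open>The cubic factors as \<open>d * t = (- a) ^ 3\<close> with coprime
  \<open>d = N ^ 3\<close> and \<open>t = T ^ 3\<close>. The norm equation, for
  \<open>M = - T\<close> and \<open>V = b - c\<close>, is (b - c)^2 = (b + c)^2 - 4bc.\<close>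

lemma cubic_to_norm_equation:
  fixes a b c :: int
  assumes eq: "18 * a ^ 3 + b ^ 3 + c ^ 3 = 9 * a * b * c" and "coprime b c" "a \<noteq> 0"
  shows "\<exists>M N V. V ^ 2 + 3 * (N * (N ^ 2 - 3 * M)) ^ 2 = 4 * M ^ 3 \<and> coprime M N
           \<and> N \<noteq> 0 \<and> \<bar>N\<bar> \<le> \<bar>a\<bar>"
proof -
  have "b ^ 3 + c ^ 3 = 3 * (3 * a * b * c - 6 * a ^ 3)"
    using eq by simp
  then have "3 dvd b + c"
    using three_dvd_cube_minus_self[of b] three_dvd_cube_minus_self[of c] by presburger
  then obtain s where s: "b + c = 3 * s" ..
  \<comment> \<open>These come from x^3 + y^3 + z^3 - 3xyz at (b, c, 3a): its linear factor b + c +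
    3a is \<open>3 * d\<close>, its quadratic factor is \<open>- 3 * t\<close>, and the cubic
    equation makes the product \<open>9 * a ^ 3\<close>.\<close>
  define d where "d = s + a"
  define t where "t = b * c - 9 * a ^ 2 + 9 * a * d - 3 * d ^ 2"
  have c: "c = 3 * (d - a) - b"
    using s by (simp add: d_def)
  have "9 * (d * t) = 9 * (- a) ^ 3"
    using eq by (simp add: t_def c power2_eq_square power3_eq_cube algebra_simps)
  then have dt: "d * t = (- a) ^ 3"
    by simp
  have "coprime d t"
  proof (rule int_coprimeI_prime)
    fix l :: int assume l: "prime l" "l dvd d" "l dvd t"
    then have "l dvd (- a) ^ 3"
      by (simp flip: dt)
    then have "l dvd a"
      using prime_dvd_power[OF l(1), of "- a" 3] by simp
    have "b * c = t + 9 * a ^ 2 - 9 * a * d + 3 * d ^ 2"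
      by (simp add: t_def)
    also have "l dvd \<dots>"
      using l \<open>l dvd a\<close> by (simp add: power2_eq_square)
    finally have "l dvd b \<or> l dvd c"
      using l(1) by (simp add: prime_dvd_mult_iff)
    moreover have "l dvd b + c"
      using l(2) \<open>l dvd a\<close> by (simp add: c)
    ultimately have "l dvd b" "l dvd c"
      by (auto simp: dvd_add_left_iff dvd_add_right_iff)
    then show False
      using l(1) assms(2) coprime_common_divisor not_prime_unit by blast
  qed
  then obtain N where N: "d = N ^ 3"
    using coprime_mult_eq_cube_int dt by blast
  obtain T where T: "t = T ^ 3"
    using coprime_mult_eq_cube_int[of t d "- a"] dt \<open>coprime d t\<close> by (auto simp: coprime_commute mult.commute)
  have "(N * T) ^ 3 = (- a) ^ 3"
    using dt by (simp add: N T power_mult_distrib)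
  then have a: "a = - (N * T)"
    by (simp only: int_cube_inject)
  have "b * c = T ^ 3 + 9 * N ^ 2 * T ^ 2 + 9 * (N ^ 3 * N * T) + 3 * (N ^ 3) ^ 2"
    using T by (simp add: t_def N a power2_eq_square power3_eq_cube algebra_simps)
  moreover have "b + c = 3 * (N ^ 3 + N * T)"
    by (simp add: c N a)
  moreover have "(b - c) ^ 2 = (b + c) ^ 2 - 4 * (b * c)"
    by (simp add: power2_eq_square algebra_simps)
  ultimately have "(b - c) ^ 2 + 3 * (N * (N ^ 2 - 3 * (- T))) ^ 2 = 4 * (- T) ^ 3"
    by (simp add: power2_eq_square power3_eq_cube algebra_simps)
  moreover have "coprime (- T) N"
    using \<open>coprime d t\<close> by (simp add: N T coprime_commute)
  moreover have "N \<noteq> 0" "T \<noteq> 0"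
    using assms(3) a by auto
  moreover from this have "\<bar>N\<bar> \<le> \<bar>a\<bar>"
    by (simp add: a abs_mult)
  ultimately show ?thesis
    by blast
qed

text \<open>Infinite descent on \<bar>n\<bar>. A prime common to the three members divides
  \<open>n\<close>, as its cube cannot divide 18, and can be cancelled. A primitive triple passes
  through both isogenies to a triple with parameter \<open>k = N / 3\<close>.\<close>

lemma no_sum_9_product_18:
  fixes u v w n :: int
  assumes "u + v + w = 9 * n" "u * v * w = 18 * n ^ 3"
  shows "n = 0"
  using assms
proof (induction "nat \<bar>n\<bar>" arbitrary: n u v w rule: less_induct)
  case less
  show ?case
  proof (rule ccontr)
    assume "n \<noteq> 0"
    have prim: False if l: "prime l" "l dvd u" "l dvd v" "l dvd w" for l
    proof -
      obtain u' v' w' where uvw: "u = l * u'" "v = l * v'" "w = l * w'"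
        using l(2-4) by (meson dvdE)
      have l2: "l \<ge> 2"
        using l(1) by (rule prime_ge_2_int)
      have "l dvd n"
      proof (rule ccontr)
        assume "\<not> l dvd n"
        then have "coprime (l ^ 3) (n ^ 3)"
          using l(1) by (simp add: prime_imp_coprime)
        moreover have "l ^ 3 * (u' * v' * w') = 18 * n ^ 3"
          unfolding less.prems(2)[symmetric] by (simp add: uvw power3_eq_cube)
        then have "l ^ 3 dvd 18 * n ^ 3"
          by (metis dvd_triv_left)
        ultimately have "l ^ 3 dvd 18"
          using coprime_dvd_mult_left_iff by blast
        have "l < 3"
        proof (rule ccontr)
          assume "\<not> l < 3"
          then have "3 ^ 3 \<le> l ^ 3"
            by (intro power_mono) auto
          then show False
            using zdvd_imp_le[OF \<open>l ^ 3 dvd 18\<close>] by simp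
        qed
        then have "l = 2"
          using l2 by simp
        then show False
          using \<open>l ^ 3 dvd 18\<close> by simp
      qed
      then obtain n' where n': "n = l * n'" ..
      have "l * (u' + v' + w') = l * (9 * n')"
        using less.prems(1) by (simp add: uvw n' algebra_simps)
      moreover have "l ^ 3 * (u' * v' * w') = l ^ 3 * (18 * n' ^ 3)"
        using less.prems(2) by (simp add: uvw n' power3_eq_cube algebra_simps)
      moreover have "n' \<noteq> 0" "nat \<bar>n'\<bar> < nat \<bar>n\<bar>"
        using \<open>n \<noteq> 0\<close> l2 by (auto simp: n' abs_mult)
      ultimately show False
        using less.hyps[of n' u' v' w'] l2 by simp
    qed
    obtain a b c where abc: "18 * a ^ 3 + b ^ 3 + c ^ 3 = 9 * a * b * c" "a * b * c = n" "coprime b c"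
      using descent_primal[OF less.prems] prim by blast
    then have "a \<noteq> 0" "b * c \<noteq> 0"
      using \<open>n \<noteq> 0\<close> by auto
    from this(2) have "1 \<le> \<bar>b * c\<bar>"
      by linarith
    moreover have "\<bar>n\<bar> = \<bar>a\<bar> * \<bar>b * c\<bar>"
      by (simp add: abs_mult flip: abc(2))
    ultimately have "\<bar>a\<bar> \<le> \<bar>n\<bar>"
      using mult_left_mono[of 1 "\<bar>b * c\<bar>" "\<bar>a\<bar>"] by simp
    obtain M N V where MNV: "V ^ 2 + 3 * (N * (N ^ 2 - 3 * M)) ^ 2 = 4 * M ^ 3" "coprime M N"
        "N \<noteq> 0" "\<bar>N\<bar> \<le> \<bar>a\<bar>"
      using cubic_to_norm_equation[OF abc(1,3) \<open>a \<noteq> 0\<close>] by blast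
    obtain p q where pq: "N ^ 3 - 3 * N * (p ^ 2 + 3 * q ^ 2) = 6 * q * (p ^ 2 - q ^ 2)"
      using descent_dual[OF MNV(1,2)] by blast
    have "N ^ 3 = 3 * (2 * q * (p ^ 2 - q ^ 2) + N * (p ^ 2 + 3 * q ^ 2))"
      using pq by simp
    then have "3 dvd N"
      using prime_dvd_power[of "3::int" N 3] by simp
    then obtain k where k: "N = 3 * k" ..
    \<comment> \<open>The shifts 2q, p - q, -p - q have sum 0, pairwise products adding up to -(p^2
      + 3q^2), and product -2q(p^2 - q^2). This turns the equation for \<open>N\<close> into a
      statement about the product of the three terms.\<close>
    have "(N + 2 * q) + (N + p - q) + (N - p - q) = 9 * k"
      by (simp add: k)
    moreover have "3 * ((N + 2 * q) * (N + p - q) * (N - p - q)) = 2 * N ^ 3"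
      using pq by (simp add: power2_eq_square power3_eq_cube algebra_simps)
    then have "(N + 2 * q) * (N + p - q) * (N - p - q) = 18 * k ^ 3"
      by (simp add: k power_mult_distrib mult_ac)
    moreover have "nat \<bar>k\<bar> < nat \<bar>n\<bar>"
      using MNV(3,4) \<open>\<bar>a\<bar> \<le> \<bar>n\<bar>\<close> k by linarith
    ultimately have "k = 0"
      using less.hyps by blast
    then show False
      using MNV(3) k by simp
  qed
qed

lemma no_sum_9_product_18_rat:
  fixes u v w n :: rat
  assumes "u + v + w = 9 * n" "u * v * w = 18 * n ^ 3"
  shows "n = 0"
proof -
  have quot: "\<exists>a b. b > 0 \<and> x = of_int a / of_int b" for x :: rat
    by (metis quotient_of_denom_pos quotient_of_div surj_pair)
  obtain a a' where a: "a' > 0" "u = of_int a / of_int a'" using quot by blast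
  obtain b b' where b: "b' > 0" "v = of_int b / of_int b'" using quot by blast
  obtain c c' where c: "c' > 0" "w = of_int c / of_int c'" using quot by blast
  obtain d d' where d: "d' > 0" "n = of_int d / of_int d'" using quot by blast
  define D :: rat where "D = of_int (a' * b' * c' * d')"
  have D: "D * u = of_int (a * b' * c' * d')" "D * v = of_int (a' * b * c' * d')"
      "D * w = of_int (a' * b' * c * d')" "D * n = of_int (a' * b' * c' * d)"
    using a b c d by (simp_all add: D_def)
  have "D * u + D * v + D * w = 9 * (D * n)" "(D * u) * (D * v) * (D * w) = 18 * (D * n) ^ 3"
    using assms by (simp_all add: power3_eq_cube algebra_simps flip: distrib_left)
  then have "(of_int (a * b' * c' * d' + a' * b * c' * d' + a' * b' * c * d') :: rat) = of_int (9 * (a' * b' * c' * d))"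
    "(of_int ((a * b' * c' * d') * (a' * b * c' * d') * (a' * b' * c * d')) :: rat) = of_int (18 * (a' * b' * c' * d) ^ 3)"
    unfolding D by simp_all
  then have "a' * b' * c' * d = 0"
    unfolding of_int_eq_iff by (rule no_sum_9_product_18)
  then show ?thesis
    using a(1) b(1) c(1) d by auto
qed

subsection \<open>Cubic factors of \<open>h(x\<^sup>3)\<close>\<close>

lemma linear_poly_has_root:
  fixes p :: "'a::field poly"
  assumes "degree p = 1"
  shows "\<exists>x. poly p x = 0"
proof -
  obtain a b where "p = [:a, b:]" "b \<noteq> 0"
    using degree1_coeffs[OF assms] by blast
  then show ?thesis
    by (intro exI[of _ "- a / b"]) simp
qed

text \<open>A nontrivial common divisor would have degree 1 or 2, so it or its cofactor in
  \<open>p\<close> would be linear and supply a root.\<close>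

lemma coprime_no_root_degree_3:
  fixes p q :: "'a::field_gcd poly"
  assumes "degree p = 3" "\<And>x. poly p x \<noteq> 0" "degree q < 3" "q \<noteq> 0"
  shows "coprime p q"
proof -
  define d where "d = gcd p q"
  have "d dvd p" "d dvd q"
    by (simp_all add: d_def)
  then obtain k where k: "p = d * k"
    by blast
  have "p \<noteq> 0"
    using assms(1) by auto
  then have "degree d + degree k = 3"
    using assms(1) k by (metis degree_mult_eq mult_eq_0_iff)
  moreover have "degree d < 3"
    using \<open>d dvd q\<close> dvd_imp_degree_le[of d q] assms(3,4) by linarith
  moreover have "degree d \<noteq> 1" "degree k \<noteq> 1"
    using linear_poly_has_root[of d] linear_poly_has_root[of k] assms(2) by (auto simp: k)
  ultimately have "degree d = 0"
    by linarith
  then have "is_unit d"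
    using \<open>p \<noteq> 0\<close> k by (auto simp: is_unit_iff_degree)
  then show ?thesis
    unfolding d_def by (simp only: is_unit_gcd_iff coprime_iff_gcd_eq_1)
qed

text \<open>A Bezout identity for \<open>p\<close> and \<open>q\<close> survives substituting
  \<open>s\<close>.\<close>

lemma dvd_pcompose_coprime:
  fixes g p q s :: "'a::field_gcd poly"
  assumes "g dvd pcompose p s" "g dvd pcompose q s" "coprime p q"
  shows "is_unit g"
proof -
  obtain u v where "u * p + v * q = 1"
    using bezout_coefficients_fst_snd[of p q] assms(3) by (metis coprime_iff_gcd_eq_1)
  then have "pcompose u s * pcompose p s + pcompose v s * pcompose q s = 1"
    by (metis pcompose_1 pcompose_add pcompose_mult)
  then show ?thesis
    using assms(1,2) by (metis dvd_add dvd_mult)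
qed

text \<open>The norm is X^3 + Y^3 + Z^3 - 3XYZ for X = x^3 + c, Y = bx, Z = ax^2, and the divisor is
  X + Y + Z. The cofactor stands for g(\<zeta>x) g(\<zeta>^2 x), written out without
  \<zeta>.\<close>

lemma cubic_dvd_norm:
  fixes a b c :: "'a::comm_ring_1"
  shows "[:c, b, a, 1:] dvd
    pcompose [:c ^ 3, b ^ 3 - 3 * a * b * c + 3 * c ^ 2, a ^ 3 - 3 * a * b + 3 * c, 1:] (monom 1 3)"
proof
  show "pcompose [:c ^ 3, b ^ 3 - 3 * a * b * c + 3 * c ^ 2, a ^ 3 - 3 * a * b + 3 * c, 1:] (monom 1 3)
    = [:c, b, a, 1:] * [:c ^ 2, - b * c, b ^ 2 - a * c, 2 * c - a * b, a ^ 2 - b, - a, 1:]"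
    by (simp add: pcompose_pCons monom_Suc monom_0 numeral_3_eq_3 power2_eq_square algebra_simps)
qed

text \<open>Two monic cubics whose substitutions share the factor differ by a polynomial of degree
  below 3. Were it nonzero, it would be coprime to the rootless cubic, making the common factor a
  unit.\<close>

lemma cubic_dvd_imp_eq_norm:
  fixes a b c s t u :: "'a::field_gcd"
  assumes "[:c, b, a, 1:] dvd pcompose [:s, t, u, 1:] (monom 1 3)" "\<And>x. poly [:s, t, u, 1:] x \<noteq> 0"
  shows "s = c ^ 3" "t = b ^ 3 - 3 * a * b * c + 3 * c ^ 2" "u = a ^ 3 - 3 * a * b + 3 * c"
proof -
  define q where "q = [:c ^ 3, b ^ 3 - 3 * a * b * c + 3 * c ^ 2, a ^ 3 - 3 * a * b + 3 * c, 1:] - [:s, t, u, 1:]"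
  have "[:c, b, a, 1:] dvd pcompose q (monom 1 3)"
    unfolding q_def pcompose_diff using cubic_dvd_norm assms(1) by (rule dvd_diff)
  moreover have "\<not> is_unit [:c, b, a, 1:]"
    by (simp add: is_unit_iff_degree)
  ultimately have "\<not> coprime [:s, t, u, 1:] q"
    using dvd_pcompose_coprime assms(1) by blast
  moreover have "degree q < 3"
    by (simp add: q_def)
  ultimately have "q = 0"
    using coprime_no_root_degree_3[of "[:s, t, u, 1:]" q] assms(2) by fastforce
  then show "s = c ^ 3" "t = b ^ 3 - 3 * a * b * c + 3 * c ^ 2" "u = a ^ 3 - 3 * a * b + 3 * c"
    by (simp_all add: q_def)
qed

text \<open>The hypothesis reflects the coefficients \<open>r ^ 2\<close> and \<open>r\<close> of h.
  The descent leaves \<open>a = 0\<close> or \<open>t = 0\<close>; in the latter case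
  \<open>u = 0\<close> or \<open>v = 0\<close> determines \<open>c\<close>.\<close>

lemma norm_coefficients_square:
  fixes a b c :: rat
  assumes "b ^ 3 - 3 * a * b * c + 3 * c ^ 2 = (a ^ 3 - 3 * a * b + 3 * c) ^ 2"
  shows "a = 0 \<and> 6 * c ^ 2 = b ^ 3 \<or> b = a ^ 2 \<and> (c = a ^ 3 \<or> c = a ^ 3 / 2)"
proof -
  define u v t where "u = c + a ^ 3 - 2 * a * b" and "v = 2 * c - a * b" and "t = b - a ^ 2"
  have uvt: "3 * u * v = t ^ 3"
    using assms unfolding u_def v_def t_def
    by (simp add: power2_eq_square power3_eq_cube algebra_simps)
  have "- (a * t) / 3 = 0"
  proof (rule no_sum_9_product_18_rat)
    show "2 * u + (- v) + a ^ 3 = 9 * (- (a * t) / 3)"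
      by (simp add: u_def v_def t_def power2_eq_square power3_eq_cube algebra_simps)
    have "3 * (2 * u * (- v) * a ^ 3) = - 2 * (3 * u * v) * a ^ 3"
      by simp
    also have "\<dots> = - 2 * (a * t) ^ 3"
      by (simp add: uvt power_mult_distrib)
    finally show "2 * u * (- v) * a ^ 3 = 18 * (- (a * t) / 3) ^ 3"
      by (simp add: power_divide)
  qed
  then consider "a = 0" | "t = 0"
    by auto
  then show ?thesis
  proof cases
    case 1
    then show ?thesis
      using assms by simp
  next
    case 2
    then have "u = 0 \<or> v = 0"
      using uvt by simp
    then show ?thesis
      using 2 by (auto simp: u_def v_def t_def power2_eq_square power3_eq_cube)
  qed
qed

theorem theorem6p4:
  fixes A B r :: rat
  assumes "A * B \<noteq> 0"
    and "poly (monom 1 4 + monom A 1 + [:B:]) r = 0"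
    and "has_cubic_factor (trinomial A B div (monom 1 3 - [:r:]))"
  shows
    "(\<exists>w. r * w * (r - w) \<noteq> 0 \<and>
        (A, B) = (- (r - w) * (r^2 + w^2), - r * w * (r^2 - r * w + w^2)) \<and>
        trinomial A B =
          (monom 1 3 - [:r:]) * (monom 1 3 + [:w:]) *
          (monom 1 6 + monom (r - w) 3 + [:r^2 - r * w + w^2:])) \<or>
     (eq_up_to_scaling (A, B) (128, 256) \<and>
        trinomial 128 256 =
          [:4, 0, 0, 1:] * [:4, 4, 2, 1:] * [:16, -16, 8, 0, 0, -2, 1:]) \<or>
     (eq_up_to_scaling (A, B) (-5616, -3888) \<and>
        trinomial (-5616) (-3888) =
          [:-18, 0, 0, 1:] * [:6, 6, 0, 1:] * [:36, -36, 36, 12, -6, 0, 1:])"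
proof -
  have factor1: "trinomial 128 256 =
      [:4, 0, 0, 1:] * [:4, 4, 2, 1:] * [:16, -16, 8, 0, 0, -2, 1:]"
    by (simp add: trinomial_def monom_altdef eval_nat_numeral)
  have factor2: "trinomial (-5616) (-3888) =
      [:-18, 0, 0, 1:] * [:6, 6, 0, 1:] * [:36, -36, 36, 12, -6, 0, 1:]"
    by (simp add: trinomial_def monom_altdef eval_nat_numeral)
  define s where "s = r ^ 3 + A"
  define h where "h = [:s, r ^ 2, r, 1:]"
  have A: "A = s - r ^ 3"
    by (simp add: s_def)
  have "r ^ 4 + A * r + B = 0"
    using assms(2) by (simp add: poly_monom)
  moreover have "r ^ 4 = r * r ^ 3"
    by (simp add: eval_nat_numeral)
  ultimately have B: "B = - r * s"
    by (simp add: s_def algebra_simps)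
  have nz: "r \<noteq> 0" "s \<noteq> 0" "s \<noteq> r ^ 3"
    using assms(1) by (auto simp: A B)
  have "trinomial A B = (monom 1 3 - [:r:]) * pcompose h (monom 1 3)"
    by (simp add: trinomial_def h_def A B pcompose_pCons monom_altdef eval_nat_numeral algebra_simps)
  moreover have "monom 1 3 - [:r:] \<noteq> 0"
    by (simp add: monom_altdef eval_nat_numeral)
  ultimately have "has_cubic_factor (pcompose h (monom 1 3))"
    using assms(3) by simp
  then obtain g where g: "degree g = 3" "g dvd pcompose h (monom 1 3)"
    unfolding has_cubic_factor_def by blast
  show ?thesis
  proof (cases "\<exists>x. poly h x = 0")
    case True
    then obtain x where "poly h x = 0" ..
    define w where "w = - x"
    have s: "s = w * (r ^ 2 - r * w + w ^ 2)"
      using \<open>poly h x = 0\<close> by (simp add: h_def w_def power2_eq_square algebra_simps)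
    have "r * w * (r - w) \<noteq> 0"
      using nz by (auto simp: s power2_eq_square power3_eq_cube)
    moreover have "A = - (r - w) * (r ^ 2 + w ^ 2)" "B = - r * w * (r ^ 2 - r * w + w ^ 2)"
      by (simp_all add: A B s power2_eq_square power3_eq_cube algebra_simps)
    moreover from this have "trinomial A B = (monom 1 3 - [:r:]) * (monom 1 3 + [:w:]) *
          (monom 1 6 + monom (r - w) 3 + [:r^2 - r * w + w^2:])"
      by (simp add: trinomial_def monom_altdef eval_nat_numeral algebra_simps)
    ultimately show ?thesis
      by blast
  next
    case False
    define k where "k = lead_coeff g"
    have "k \<noteq> 0"
      using g(1) by (metis k_def degree_0 leading_coeff_0_iff zero_neq_numeral)
    define a b c where "a = coeff g 2 / k" and "b = coeff g 1 / k" and "c = coeff g 0 / k"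
    have "g = smult k [:c, b, a, 1:]"
    proof (rule poly_eqI)
      fix i :: nat
      consider "i = 0" | "i = 1" | "i = 2" | "i = 3" | "i > 3"
        by linarith
      then show "coeff g i = coeff (smult k [:c, b, a, 1:]) i"
        using \<open>k \<noteq> 0\<close> g(1)
        by cases (auto simp: a_def b_def c_def k_def coeff_eq_0 eval_nat_numeral)
    qed
    then have "[:c, b, a, 1:] dvd pcompose h (monom 1 3)"
      using g(2) smult_dvd_cancel by metis
    then have eqs: "s = c ^ 3" "r ^ 2 = b ^ 3 - 3 * a * b * c + 3 * c ^ 2" "r = a ^ 3 - 3 * a * b + 3 * c"
      using cubic_dvd_imp_eq_norm[of c b a s "r ^ 2" r] False unfolding h_def by blast+
    have "c \<noteq> 0"
      using nz(2) eqs(1) by auto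
    from eqs have "b ^ 3 - 3 * a * b * c + 3 * c ^ 2 = (a ^ 3 - 3 * a * b + 3 * c) ^ 2"
      by simp
    then consider "a = 0" "6 * c ^ 2 = b ^ 3" | "b = a ^ 2" "c = a ^ 3" | "b = a ^ 2" "c = a ^ 3 / 2"
      using norm_coefficients_square by blast
    then show ?thesis
    proof cases
      case 1
      then have "b \<noteq> 0"
        using \<open>c \<noteq> 0\<close> by auto
      \<comment> \<open>Parametrizes the cuspidal curve 6c^2 = b^3 by the slope c/b;
        \<open>l = 1\<close> gives the factor x^3 + 6x + 6.\<close>
      define l where "l = c / b"
      have "l \<noteq> 0"
        using \<open>b \<noteq> 0\<close> \<open>c \<noteq> 0\<close> by (simp add: l_def)
      have "b ^ 2 * b = b ^ 2 * (6 * l ^ 2)"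
        using 1(2) \<open>b \<noteq> 0\<close> by (simp add: l_def power_divide power2_eq_square power3_eq_cube)
      then have "b = 6 * l ^ 2"
        using \<open>b \<noteq> 0\<close> by simp
      then have "c = 6 * l ^ 3"
        using \<open>b \<noteq> 0\<close> by (simp add: l_def power2_eq_square power3_eq_cube field_simps)
      have "A = - 5616 * l ^ 9" "B = - 3888 * l ^ 12"
        using eqs 1(1) \<open>c = 6 * l ^ 3\<close> by (simp_all add: A B power_mult_distrib flip: power_mult power_add)
      then have "eq_up_to_scaling (A, B) (- 5616, - 3888)"
        using \<open>l \<noteq> 0\<close> by (auto simp: eq_up_to_scaling_def)
      then show ?thesis
        using factor2 by blast
    next
      case 2
      \<comment> \<open>Here \<open>s = c ^ 3 = r ^ 3\<close>, that is,
        \<open>A = 0\<close>.\<close>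
      have "r = a ^ 3"
        using eqs(3) 2 by (simp add: power2_eq_square power3_eq_cube)
      then have False
        using nz(3) eqs(1) 2 by simp
      then show ?thesis ..
    next
      case 3
      \<comment> \<open>Normalized so that \<open>l = 1\<close> gives x^3 + 2x^2 + 4x + 4.\<close>
      define l where "l = a / 2"
      have a: "a = 2 * l"
        by (simp add: l_def)
      have c: "c = 4 * l ^ 3"
        using 3 by (simp add: a power_mult_distrib)
      have r: "r = - 4 * l ^ 3"
        using eqs(3) 3 by (simp add: a power2_eq_square power3_eq_cube)
      have "l \<noteq> 0"
        using \<open>c \<noteq> 0\<close> c by auto
      moreover have "A = 128 * l ^ 9" "B = 256 * l ^ 12"
        using eqs(1) r c by (simp_all add: A B power_mult_distrib flip: power_mult power_add)
      ultimately have "eq_up_to_scaling (A, B) (128, 256)"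
        by (auto simp: eq_up_to_scaling_def)
      then show ?thesis
        using factor1 by blast
    qed
  qed
qed

end
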